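(* $\mathfrak{sft}$ is a dense subset of $\mathfrak{S}$ (with respect to the Hausdorff metric $d_H$).
   Context: On $\mathbb{N}^{\mathbb{Z}}$ and its subspaces use the metric $d(x,y)=\inf\{2^{-m}:x_n=y_n\text{ for }|n|<m\}$; $\sigma$ is the shift $(\sigma(x))_i=x_{i+1}$. For a finite alphabet $\mathcal{A}$, a shift space is a nonempty closed shift-invariant subset $X\subseteq\mathcal{A}^{\mathbb{Z}}$; every shift space is of the form $X=X_{\mathcal{F}}$, the set of all sequences in $\mathcal{A}^{\mathbb{Z}}$ in which no word from some collection $\mathcal{F}$ of forbidden finite words appears. It is a subshift of finite type (SFT) if $\mathcal{F}$ can be taken finite. $\mathfrak{S}$ is the set of all shift spaces of bi-infinite sequences over a finite alphabet of cardinality at least $2$, each regarded (after relabelling the alphabet) as a subset of $\{1,\dots,k\}^{\mathbb{Z}}$ for some $k\ge2$, hence as a compact subset of $\mathbb{N}^{\mathbb{Z}}$; thus $\mathfrak{S}\subseteq\mathcal{K}(\mathbb{N}^{\mathbb{Z}})$, the space of nonempty compact subsets of $\mathbb{N}^{\mathbb{Z}}$, with the Hausdorff metric $d_H(A,B)=\max\{\sup_{a\in A}d(a,B),\sup_{b\in B}d(b,A)\}$. $\mathfrak{sft}\subseteq\mathfrak{S}$ is the subclass of all subshifts of finite type. *)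

theory Defs
  imports "HOL-Analysis.Analysis"
begin

section \<open>The space of bi-infinite sequences of natural numbers\<close>

definition seq_dist :: "(int \<Rightarrow> nat) \<Rightarrow> (int \<Rightarrow> nat) \<Rightarrow> real" where
  "seq_dist x y = Inf {(1/2) ^ m | m :: nat. \<forall>n :: int. \<bar>n\<bar> < int m \<longrightarrow> x n = y n}"

lemma seq_dist_le_iff:
  "seq_dist x y \<le> (1/2) ^ m \<longleftrightarrow> (\<forall>n :: int. \<bar>n\<bar> < int m \<longrightarrow> x n = y n)"
proof -
  let ?P = "\<lambda>m :: nat. \<forall>n :: int. \<bar>n\<bar> < int m \<longrightarrow> x n = y n"
  let ?S = "{(1/2 :: real) ^ m | m. ?P m}"
  have bdd: "bdd_below ?S"
    by (rule bdd_belowI[of _ 0]) auto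
  have P0: "?P 0" by auto
  then have ne: "?S \<noteq> {}" by blast
  show ?thesis
  proof
    assume "?P m"
    then show "seq_dist x y \<le> (1/2) ^ m"
      unfolding seq_dist_def by (intro cInf_lower bdd) blast
  next
    assume le: "seq_dist x y \<le> (1/2) ^ m"
    show "?P m"
    proof (rule ccontr)
      assume nP: "\<not> ?P m"
      have "m > 0" using nP P0 by (cases m) auto
      then obtain m' where m': "m = Suc m'" by (cases m) auto
      have "(1/2) ^ m' \<le> seq_dist x y"
        unfolding seq_dist_def
      proof (rule cInf_greatest[OF ne])
        fix r :: real assume "r \<in> ?S"
        then obtain j where j: "r = (1/2) ^ j" "?P j" by blast
        have "j \<le> m'"
        proof (rule ccontr)
          assume "\<not> j \<le> m'"
          then have "?P m" using j(2) m' by auto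
          then show False using nP by simp
        qed
        then show "(1/2) ^ m' \<le> r"
          unfolding j(1) by (intro power_decreasing) auto
      qed
      with le have "(1/2 :: real) ^ m' \<le> (1/2) ^ m" by linarith
      then show False by (simp add: m')
    qed
  qed
qed

lemma seq_dist_nonneg: "seq_dist x y \<ge> 0"
proof -
  have "{(1/2 :: real) ^ m | m. \<forall>n :: int. \<bar>n\<bar> < int m \<longrightarrow> x n = y n} \<noteq> {}"
    by (auto intro!: exI[of _ 0])
  then show ?thesis
    unfolding seq_dist_def by (rule cInf_greatest) auto
qed

lemma seq_dist_le_1: "seq_dist x y \<le> 1"
  using seq_dist_le_iff[of x y 0] by simp

lemma seq_dist_commute: "seq_dist x y = seq_dist y x"
proof -
  have "(\<forall>n :: int. \<bar>n\<bar> < int m \<longrightarrow> x n = y n) \<longleftrightarrow> (\<forall>n :: int. \<bar>n\<bar> < int m \<longrightarrow> y n = x n)"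
    for m by auto
  then show ?thesis unfolding seq_dist_def by presburger
qed

lemma seq_dist_eq_0_iff: "seq_dist x y = 0 \<longleftrightarrow> x = y"
proof
  assume "seq_dist x y = 0"
  then have "seq_dist x y \<le> (1/2) ^ m" for m by simp
  then have *: "\<bar>n\<bar> < int m \<Longrightarrow> x n = y n" for m n unfolding seq_dist_le_iff by blast
  show "x = y"
  proof
    fix n :: int
    show "x n = y n" by (rule *[of n "nat (\<bar>n\<bar> + 1)"]) simp
  qed
next
  assume "x = y"
  then have le: "seq_dist x y \<le> (1/2) ^ m" for m by (simp add: seq_dist_le_iff)
  show "seq_dist x y = 0"
  proof (rule ccontr)
    assume "seq_dist x y \<noteq> 0"
    then have "seq_dist x y > 0" using seq_dist_nonneg[of x y] by linarith
    then obtain m where "(1/2 :: real) ^ m < seq_dist x y"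
      using real_arch_pow_inv[of "seq_dist x y" "1/2"] by auto
    with le[of m] show False by linarith
  qed
qed

lemma seq_dist_cases: obtains "seq_dist x y = 0" | m where "seq_dist x y = (1/2) ^ m"
proof (cases "seq_dist x y = 0")
  case False
  then have "x \<noteq> y" by (simp add: seq_dist_eq_0_iff)
  then obtain n where n: "x n \<noteq> y n" by auto
  let ?P = "\<lambda>m :: nat. \<forall>n :: int. \<bar>n\<bar> < int m \<longrightarrow> x n = y n"
  have bound: "?P m \<Longrightarrow> m \<le> nat \<bar>n\<bar>" for m
    using n by (meson leI zless_nat_eq_int_zless nat_less_iff abs_ge_zero)
  define m where "m = (GREATEST m. ?P m)"
  have P: "?P m" unfolding m_def
    by (rule GreatestI_nat[of ?P 0]) (use bound in auto)
  have mx: "?P j \<Longrightarrow> j \<le> m" for j unfolding m_def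
    by (rule Greatest_le_nat[of ?P]) (use bound in auto)
  have "seq_dist x y = (1/2) ^ m"
    unfolding seq_dist_def
  proof (rule cInf_eq_minimum)
    show "(1/2) ^ m \<in> {(1/2 :: real) ^ m | m. ?P m}" using P by blast
    fix r :: real assume "r \<in> {(1/2) ^ m | m. ?P m}"
    then show "(1/2) ^ m \<le> r" using mx by (auto intro!: power_decreasing)
  qed
  then show ?thesis using that by blast
qed (use that in blast)

lemma seq_dist_ultra: "seq_dist x z \<le> max (seq_dist x y) (seq_dist y z)"
proof -
  have le: "seq_dist x z \<le> (1/2) ^ m"
    if "seq_dist x y \<le> (1/2) ^ m" "seq_dist y z \<le> (1/2) ^ m" for m
    using that unfolding seq_dist_le_iff by simp
  show ?thesis
  proof (cases "seq_dist x y \<le> seq_dist y z")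
    case True
    show ?thesis
    proof (cases rule: seq_dist_cases[of y z])
      case 1
      then have "x = y" "y = z"
        using True seq_dist_nonneg[of x y] seq_dist_eq_0_iff by (metis order_antisym)+
      then show ?thesis by simp
    next
      case (2 m)
      then show ?thesis using le[of m] True by simp
    qed
  next
    case False
    show ?thesis
    proof (cases rule: seq_dist_cases[of x y])
      case 1
      then show ?thesis using False seq_dist_nonneg[of y z] by linarith
    next
      case (2 m)
      then show ?thesis using le[of m] False by simp
    qed
  qed
qed

interpretation seq: Metric_space "UNIV :: (int \<Rightarrow> nat) set" seq_dist
proof
  fix x y z
  show "0 \<le> seq_dist x y" by (rule seq_dist_nonneg)
  show "seq_dist x y = seq_dist y x" by (rule seq_dist_commute)
  show "seq_dist x y = 0 \<longleftrightarrow> x = y" by (rule seq_dist_eq_0_iff)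
  show "seq_dist x z \<le> seq_dist x y + seq_dist y z"
    using seq_dist_ultra[of x z y] seq_dist_nonneg[of x y] seq_dist_nonneg[of y z] by linarith
qed

abbreviation seq_topology :: "(int \<Rightarrow> nat) topology" where
  "seq_topology \<equiv> Metric_space.mtopology UNIV seq_dist"

section \<open>The Hausdorff metric\<close>

definition compact_subsets :: "(int \<Rightarrow> nat) set set" where
  "compact_subsets = {A. A \<noteq> {} \<and> compactin seq_topology A}"

definition point_set_dist :: "(int \<Rightarrow> nat) \<Rightarrow> (int \<Rightarrow> nat) set \<Rightarrow> real" where
  "point_set_dist a B = (INF b\<in>B. seq_dist a b)"

(* The empty set is never a point of the space; the value 0 is there because the locale Metric_space
   asks for a nonnegative function on the whole type, while Sup {} is unspecified on the reals. *)
definition hausdorff_dist :: "(int \<Rightarrow> nat) set \<Rightarrow> (int \<Rightarrow> nat) set \<Rightarrow> real" where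
  "hausdorff_dist A B = (if A = {} \<or> B = {} then 0 else
     max (SUP a\<in>A. point_set_dist a B) (SUP b\<in>B. point_set_dist b A))"

lemma point_set_dist_le: "b \<in> B \<Longrightarrow> point_set_dist a B \<le> seq_dist a b"
  unfolding point_set_dist_def
  by (rule cINF_lower) (auto intro!: bdd_belowI[of _ 0] seq_dist_nonneg)

lemma point_set_dist_nonneg: "B \<noteq> {} \<Longrightarrow> point_set_dist a B \<ge> 0"
  unfolding point_set_dist_def by (rule cINF_greatest) (auto simp: seq_dist_nonneg)

lemma point_set_dist_le_1: "B \<noteq> {} \<Longrightarrow> point_set_dist a B \<le> 1"
  using point_set_dist_le seq_dist_le_1 by (meson equals0I order_trans)

lemma point_set_dist_less:
  assumes "B \<noteq> {}" "point_set_dist a B < r"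
  obtains b where "b \<in> B" "seq_dist a b < r"
proof -
  have "bdd_below (seq_dist a ` B)" by (auto intro!: bdd_belowI[of _ 0] seq_dist_nonneg)
  then show ?thesis
    using assms that unfolding point_set_dist_def by (subst (asm) cINF_less_iff) auto
qed

lemma hausdorff_dist_le_iff:
  assumes "A \<noteq> {}" "B \<noteq> {}"
  shows "hausdorff_dist A B \<le> r \<longleftrightarrow>
    (\<forall>a\<in>A. point_set_dist a B \<le> r) \<and> (\<forall>b\<in>B. point_set_dist b A \<le> r)"
proof -
  have "bdd_above ((\<lambda>a. point_set_dist a B) ` A)" "bdd_above ((\<lambda>b. point_set_dist b A) ` B)"
    using assms by (auto intro!: bdd_aboveI[of _ 1] point_set_dist_le_1)
  then show ?thesis
    using assms unfolding hausdorff_dist_def by (simp add: cSUP_le_iff)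
qed

lemma hausdorff_dist_commute: "hausdorff_dist A B = hausdorff_dist B A"
  unfolding hausdorff_dist_def by (simp add: max.commute)

lemma point_set_dist_le_hausdorff_dist:
  assumes "A \<noteq> {}" "B \<noteq> {}" "a \<in> A"
  shows "point_set_dist a B \<le> hausdorff_dist A B"
  using hausdorff_dist_le_iff[OF assms(1,2), of "hausdorff_dist A B"] assms(3) by auto

lemma hausdorff_dist_nonneg:
  assumes "A \<noteq> {}" "B \<noteq> {}"
  shows "hausdorff_dist A B \<ge> 0"
  using assms point_set_dist_le_hausdorff_dist point_set_dist_nonneg
  by (meson equals0I order_trans)

lemma hausdorff_dist_self: "A \<noteq> {} \<Longrightarrow> hausdorff_dist A A = 0"
proof -
  assume A: "A \<noteq> {}"
  have "point_set_dist a A \<le> 0" if "a \<in> A" for a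
    using point_set_dist_le[OF that, of a] by simp
  then have "hausdorff_dist A A \<le> 0" using A by (simp add: hausdorff_dist_le_iff)
  with hausdorff_dist_nonneg[OF A A] show ?thesis by linarith
qed

lemma hausdorff_dist_0_subset:
  assumes "A \<noteq> {}" "B \<noteq> {}" "closedin seq_topology B" "hausdorff_dist A B = 0"
  shows "A \<subseteq> B"
proof
  fix a assume a: "a \<in> A"
  have "\<exists>b\<in>B. b \<in> seq.mball a r" if "r > 0" for r
  proof -
    have "point_set_dist a B < r"
      using point_set_dist_le_hausdorff_dist[OF assms(1,2) a] assms(4) that by linarith
    then show ?thesis by (rule point_set_dist_less[OF assms(2)]) (auto simp: seq.mball_def)
  qed
  then have "a \<in> seq_topology closure_of B" by (auto simp: seq.metric_closure_of)
  then show "a \<in> B" using assms(3) by (simp add: closure_of_closedin)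
qed

lemma hausdorff_dist_triangle_aux:
  assumes "A \<noteq> {}" "B \<noteq> {}" "C \<noteq> {}" "a \<in> A"
  shows "point_set_dist a C \<le> hausdorff_dist A B + hausdorff_dist B C"
proof (rule field_le_epsilon)
  fix e :: real assume e: "e > 0"
  have "point_set_dist a B < hausdorff_dist A B + e/2"
    using point_set_dist_le_hausdorff_dist[OF assms(1,2,4)] e by linarith
  then obtain b where b: "b \<in> B" "seq_dist a b < hausdorff_dist A B + e/2"
    by (rule point_set_dist_less[OF assms(2)])
  have "point_set_dist b C < hausdorff_dist B C + e/2"
    using point_set_dist_le_hausdorff_dist[OF assms(2,3) b(1)] e by linarith
  then obtain c where c: "c \<in> C" "seq_dist b c < hausdorff_dist B C + e/2"
    by (rule point_set_dist_less[OF assms(3)])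
  show "point_set_dist a C \<le> hausdorff_dist A B + hausdorff_dist B C + e"
    using point_set_dist_le[OF c(1), of a] seq.triangle[of a b c] b(2) c(2) by simp
qed

interpretation hausdorff: Metric_space compact_subsets hausdorff_dist
proof
  fix A B :: "(int \<Rightarrow> nat) set"
  show "hausdorff_dist A B = hausdorff_dist B A" by (rule hausdorff_dist_commute)
  show "0 \<le> hausdorff_dist A B"
    by (cases "A = {} \<or> B = {}") (auto simp: hausdorff_dist_nonneg, auto simp: hausdorff_dist_def)
next
  fix A B assume "A \<in> compact_subsets" "B \<in> compact_subsets"
  then have "A \<noteq> {}" "B \<noteq> {}" "closedin seq_topology A" "closedin seq_topology B"
    by (auto simp: compact_subsets_def intro: compactin_imp_closedin seq.Hausdorff_space_mtopology)
  then show "hausdorff_dist A B = 0 \<longleftrightarrow> A = B"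
    using hausdorff_dist_0_subset[of A B] hausdorff_dist_0_subset[of B A]
      hausdorff_dist_self hausdorff_dist_commute[of A B] by auto
next
  fix A B C assume "A \<in> compact_subsets" "B \<in> compact_subsets" "C \<in> compact_subsets"
  then have ne: "A \<noteq> {}" "B \<noteq> {}" "C \<noteq> {}" by (auto simp: compact_subsets_def)
  show "hausdorff_dist A C \<le> hausdorff_dist A B + hausdorff_dist B C"
    using hausdorff_dist_triangle_aux[OF ne] hausdorff_dist_triangle_aux[OF ne(3,2,1)]
    by (simp add: hausdorff_dist_le_iff ne hausdorff_dist_commute[of C] hausdorff_dist_commute[of B A]
        add.commute)
qed

section \<open>Shift spaces\<close>

definition shift_map :: "(int \<Rightarrow> nat) \<Rightarrow> int \<Rightarrow> nat" where
  "shift_map x = (\<lambda>i. x (i + 1))"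

definition full_shift :: "nat set \<Rightarrow> (int \<Rightarrow> nat) set" where
  "full_shift \<A> = {x. \<forall>i. x i \<in> \<A>}"

(* The shift is invertible, so invariance means that the image of X is X itself; mere inclusion of
   the image in X would admit closed sets that are not given by forbidden words. *)
definition shift_space :: "nat set \<Rightarrow> (int \<Rightarrow> nat) set \<Rightarrow> bool" where
  "shift_space \<A> X \<longleftrightarrow> X \<noteq> {} \<and> X \<subseteq> full_shift \<A> \<and>
     closedin (subtopology seq_topology (full_shift \<A>)) X \<and> shift_map ` X = X"

definition appears_in :: "nat list \<Rightarrow> (int \<Rightarrow> nat) \<Rightarrow> bool" where
  "appears_in w x \<longleftrightarrow> (\<exists>i. \<forall>j < length w. x (i + int j) = w ! j)"

definition avoiding :: "nat set \<Rightarrow> nat list set \<Rightarrow> (int \<Rightarrow> nat) set" where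
  "avoiding \<A> F = {x \<in> full_shift \<A>. \<forall>w\<in>F. \<not> appears_in w x}"

definition subshift_of_finite_type :: "nat set \<Rightarrow> (int \<Rightarrow> nat) set \<Rightarrow> bool" where
  "subshift_of_finite_type \<A> X \<longleftrightarrow>
     shift_space \<A> X \<and> (\<exists>F. finite F \<and> F \<subseteq> lists \<A> \<and> X = avoiding \<A> F)"

(* Every finite alphabet with at least two letters is relabelled as {1..k}; the letters in {1..k}
   need not all occur in X. *)
definition shift_spaces :: "(int \<Rightarrow> nat) set set" where
  "shift_spaces = {X. \<exists>k\<ge>2. shift_space {1..k} X}"

definition finite_type_shifts :: "(int \<Rightarrow> nat) set set" where
  "finite_type_shifts = {X. \<exists>k\<ge>2. subshift_of_finite_type {1..k} X}"

lemma finite_type_shifts_subset: "finite_type_shifts \<subseteq> shift_spaces"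
  by (auto simp: finite_type_shifts_def shift_spaces_def subshift_of_finite_type_def)

lemma compactin_full_shift:
  assumes "finite \<A>"
  shows "compactin seq_topology (full_shift \<A>)"
proof -
  let ?T = "product_topology (\<lambda>_ :: int. discrete_topology \<A>) UNIV"
  have top: "topspace ?T = full_shift \<A>"
    by (auto simp: full_shift_def PiE_def extensional_def)
  have "compact_space ?T"
    using assms by (simp add: compact_space_product_topology compact_space_discrete_topology)
  then have comp: "compactin ?T (full_shift \<A>)" unfolding compact_space_def top .
  have "continuous_map ?T seq_topology (\<lambda>x. x)"
    unfolding seq.continuous_map_to_metric
  proof (intro ballI allI impI)
    fix x and e :: real assume x: "x \<in> topspace ?T" and e: "e > 0"
    obtain m where m: "(1/2 :: real) ^ m < e" using real_arch_pow_inv[OF e, of "1/2"] by auto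
    define U where "U = (\<Pi>\<^sub>E n\<in>UNIV. if \<bar>n\<bar> < int m then {x n} else \<A>)"
    have "openin ?T U"
      unfolding U_def
    proof (rule product_topology_basis)
      show "openin (discrete_topology \<A>) (if \<bar>n\<bar> < int m then {x n} else \<A>)" for n
        using x unfolding top by (auto simp: full_shift_def)
      have "{n :: int. (if \<bar>n\<bar> < int m then {x n} else \<A>) \<noteq> topspace (discrete_topology \<A>)}
          \<subseteq> {- int m..int m}" by (auto split: if_splits)
      then show "finite {n :: int. (if \<bar>n\<bar> < int m then {x n} else \<A>)
          \<noteq> topspace (discrete_topology \<A>)}" by (rule finite_subset) simp
    qed
    moreover have "x \<in> U" using x unfolding top by (auto simp: U_def full_shift_def)
    moreover have "y \<in> seq.mball x e" if "y \<in> U" for y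
    proof -
      have "y n = x n" if "\<bar>n\<bar> < int m" for n
        using \<open>y \<in> U\<close> that unfolding U_def by (auto simp: PiE_def Pi_def dest: spec[of _ n])
      then have "seq_dist x y \<le> (1/2) ^ m" by (simp add: seq_dist_le_iff)
      with m show ?thesis by simp
    qed
    ultimately show "\<exists>U. openin ?T U \<and> x \<in> U \<and> (\<forall>y\<in>U. y \<in> seq.mball x e)" by blast
  qed
  from image_compactin[OF comp this] show ?thesis by simp
qed

lemma shift_spaces_subset: "shift_spaces \<subseteq> compact_subsets"
proof
  fix X assume "X \<in> shift_spaces"
  then obtain k where X: "shift_space {1..k} X" by (auto simp: shift_spaces_def)
  have "compactin seq_topology (full_shift {1..k})" by (rule compactin_full_shift) simp
  moreover from this have "closedin seq_topology (full_shift {1..k})"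
    by (rule compactin_imp_closedin[OF seq.Hausdorff_space_mtopology])
  ultimately have "compactin seq_topology X"
    using X unfolding shift_space_def
    by (meson closed_compactin closedin_trans_full)
  then show "X \<in> compact_subsets" using X by (simp add: compact_subsets_def shift_space_def)
qed

end

(* Keep from X only the constraint on words of length 2m: the sequences all of whose words of
   length 2m occur in X form a subshift of finite type Y containing X. The central 2m-word of any
   y in Y occurs in some x in X, and after a shift it occurs in central position, so y and the
   shifted x agree on that window and the Hausdorff distance of X and Y is at most 2^-m. *)
theory Submission
  imports Defs
begin

lemma translate_in_shift_invariant:
  assumes inv: "shift_map ` X = X" and x: "x \<in> X"
  shows "(\<lambda>n. x (n + i)) \<in> X"
proof (induction i rule: int_induct[of _ 0])
  case base
  show ?case using x by simp
next
  case (step1 i)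
  have "shift_map (\<lambda>n. x (n + i)) \<in> X" using step1(2) inv by blast
  then show ?case by (simp add: shift_map_def algebra_simps)
next
  case (step2 i)
  obtain z where z: "z \<in> X" "(\<lambda>n. x (n + i)) = shift_map z" using step2(2) inv by blast
  \<comment> \<open>The shift is injective, so the preimage supplied by surjectivity can only be the
    translate by \<open>i - 1\<close>.\<close>
  have "z = (\<lambda>n. x (n + (i - 1)))"
  proof
    fix n
    show "z n = x (n + (i - 1))"
      using fun_cong[OF z(2), of "n - 1"] by (simp add: shift_map_def algebra_simps)
  qed
  then show ?case using z(1) by simp
qed

lemma appears_in_translate: "appears_in w (\<lambda>n. x (n + c)) \<longleftrightarrow> appears_in w x"
proof
  assume "appears_in w (\<lambda>n. x (n + c))"
  then obtain i where "\<forall>j < length w. x (i + int j + c) = w ! j" by (auto simp: appears_in_def)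
  then show "appears_in w x"
    unfolding appears_in_def by (intro exI[of _ "i + c"]) (simp add: algebra_simps)
next
  assume "appears_in w x"
  then obtain i where "\<forall>j < length w. x (i + int j) = w ! j" by (auto simp: appears_in_def)
  then show "appears_in w (\<lambda>n. x (n + c))"
    unfolding appears_in_def by (intro exI[of _ "i - c"]) (simp add: algebra_simps)
qed

lemma translate_in_avoiding:
  "x \<in> avoiding \<A> F \<Longrightarrow> (\<lambda>n. x (n + c)) \<in> avoiding \<A> F"
  by (simp add: avoiding_def full_shift_def appears_in_translate)

text \<open>Avoidance does not depend on where a word sits, so translating by 1 and by -1 gives the
  two inclusions.\<close>

lemma shift_map_image_avoiding: "shift_map ` avoiding \<A> F = avoiding \<A> F"
proof
  show "shift_map ` avoiding \<A> F \<subseteq> avoiding \<A> F"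
    unfolding shift_map_def using translate_in_avoiding by blast
  show "avoiding \<A> F \<subseteq> shift_map ` avoiding \<A> F"
  proof
    fix x assume "x \<in> avoiding \<A> F"
    then have "(\<lambda>n. x (n + (- 1))) \<in> avoiding \<A> F" by (rule translate_in_avoiding)
    moreover have "x = shift_map (\<lambda>n. x (n + (- 1)))" by (simp add: shift_map_def)
    ultimately show "x \<in> shift_map ` avoiding \<A> F" by blast
  qed
qed

text \<open>One occurrence of a word reads only finitely many coordinates, so it survives in every
  sequence that agrees on a large enough central window.\<close>

lemma openin_appears_in: "openin seq_topology {x. appears_in w x}"
  unfolding seq.openin_mtopology
proof (intro conjI allI impI)
  fix x assume "x \<in> {x. appears_in w x}"
  then obtain i where i: "\<forall>j < length w. x (i + int j) = w ! j" by (auto simp: appears_in_def)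
  \<comment> \<open>All positions \<open>i + j\<close> with \<open>j < length w\<close> have
    absolute value below this \<open>m\<close>.\<close>
  define m where "m = nat \<bar>i\<bar> + length w"
  have "appears_in w y" if "seq_dist x y < (1/2) ^ m" for y
  proof -
    have eq: "\<forall>n. \<bar>n\<bar> < int m \<longrightarrow> x n = y n"
      using that seq_dist_le_iff[of x y m] by simp
    have "y (i + int j) = w ! j" if "j < length w" for j
    proof -
      have "\<bar>i + int j\<bar> < int m" using that unfolding m_def by linarith
      then show ?thesis using eq i that by metis
    qed
    then show ?thesis by (auto simp: appears_in_def)
  qed
  then show "\<exists>r>0. seq.mball x r \<subseteq> {x. appears_in w x}"
    by (intro exI[of _ "(1/2) ^ m"]) auto
qed auto

lemma closedin_avoiding:
  "closedin (subtopology seq_topology (full_shift \<A>)) (avoiding \<A> F)"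
proof -
  have "openin seq_topology (\<Union>w\<in>F. {x. appears_in w x})"
    by (intro openin_Union) (auto simp: openin_appears_in)
  then have "closedin seq_topology (UNIV - (\<Union>w\<in>F. {x. appears_in w x}))"
    using openin_closedin_eq by (metis closedin_def Diff_Diff_Int Diff_subset inf.absorb_iff2
        seq.topspace_mtopology openin_subset)
  moreover have "avoiding \<A> F = (UNIV - (\<Union>w\<in>F. {x. appears_in w x})) \<inter> full_shift \<A>"
    by (auto simp: avoiding_def)
  ultimately show ?thesis by (auto simp: closedin_subtopology)
qed

lemma subshift_of_finite_type_avoiding:
  assumes "finite F" "F \<subseteq> lists \<A>" "avoiding \<A> F \<noteq> {}"
  shows "subshift_of_finite_type \<A> (avoiding \<A> F)"
  using assms shift_map_image_avoiding closedin_avoiding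
  unfolding subshift_of_finite_type_def shift_space_def
  by (auto simp: avoiding_def)

lemma finite_type_approximation:
  assumes fin: "finite \<A>" and X: "shift_space \<A> X"
  obtains Y where "subshift_of_finite_type \<A> Y" "hausdorff_dist X Y \<le> (1/2) ^ m"
proof -
  \<comment> \<open>The window -m..m-1 contains all n with |n| < m. Finiteness of \<open>F\<close>
    comes from the fixed length over a finite alphabet. For m = 0 the empty word appears everywhere,
    so \<open>F\<close> is empty and \<open>Y\<close> the full shift.\<close>
  define F where "F = {w \<in> lists \<A>. length w = 2 * m \<and> (\<forall>x\<in>X. \<not> appears_in w x)}"
  define Y where "Y = avoiding \<A> F"
  have ne: "X \<noteq> {}" and inv: "shift_map ` X = X" using X by (auto simp: shift_space_def)
  \<comment> \<open>This inclusion makes \<open>Y\<close> nonempty and settles one half of the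
    Hausdorff distance.\<close>
  have XY: "X \<subseteq> Y"
    using X by (auto simp: Y_def F_def avoiding_def shift_space_def)
  have "finite F"
    by (rule finite_subset[OF _ finite_lists_length_eq[OF fin, of "2 * m"]]) (auto simp: F_def)
  then have sft: "subshift_of_finite_type \<A> Y"
    unfolding Y_def using ne XY
    by (intro subshift_of_finite_type_avoiding) (auto simp: F_def Y_def)
  have near_Y: "point_set_dist x Y \<le> (1/2) ^ m" if "x \<in> X" for x
  proof -
    have "point_set_dist x Y \<le> seq_dist x x" using that XY by (intro point_set_dist_le) auto
    also have "\<dots> \<le> (1/2) ^ m" by (simp add: seq_dist_le_iff)
    finally show ?thesis .
  qed
  have near_X: "point_set_dist y X \<le> (1/2) ^ m" if y: "y \<in> Y" for y
  proof -
    define w where "w = map (\<lambda>j. y (int j - int m)) [0..<2 * m]"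
    have w: "length w = 2 * m" "\<And>j. j < 2 * m \<Longrightarrow> w ! j = y (int j - int m)"
      by (auto simp: w_def)
    have "appears_in w y"
      unfolding appears_in_def by (intro exI[of _ "- int m"]) (simp add: w algebra_simps)
    then have "w \<notin> F" using y by (auto simp: Y_def avoiding_def)
    moreover have "w \<in> lists \<A>"
      using y by (auto simp: w_def Y_def avoiding_def full_shift_def)
    \<comment> \<open>Having the right length and letters, \<open>w\<close> can lie outside
      \<open>F\<close> only by occurring in some point of \<open>X\<close>.\<close>
    ultimately obtain x i where x: "x \<in> X" and i: "\<forall>j < 2 * m. x (i + int j) = w ! j"
      using w(1) by (auto simp: F_def appears_in_def)
    \<comment> \<open>Translating by \<open>i + m\<close> moves the occurrence of \<open>w\<close>
      in \<open>x\<close> from position \<open>i\<close> to position -m, where \<open>y\<close> has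
      it.\<close>
    have "y n = x (n + (i + int m))" if "\<bar>n\<bar> < int m" for n
    proof -
      define j where "j = nat (n + int m)"
      have j: "j < 2 * m" "int j = n + int m" using that unfolding j_def by linarith+
      have "x (i + int j) = y (int j - int m)" using i w(2) j(1) by simp
      then show ?thesis unfolding j(2) by (simp add: algebra_simps)
    qed
    then have "seq_dist y (\<lambda>n. x (n + (i + int m))) \<le> (1/2) ^ m"
      by (simp add: seq_dist_le_iff)
    with point_set_dist_le[OF translate_in_shift_invariant[OF inv x]] show ?thesis
      by (rule order_trans)
  qed
  have "hausdorff_dist X Y \<le> (1/2) ^ m"
    using hausdorff_dist_le_iff[of X Y] ne XY near_X near_Y by auto
  with sft that show thesis by blast
qed

theorem theorem4p1:
  shows "finite_type_shifts \<subseteq> shift_spaces \<and>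
    subtopology (Metric_space.mtopology compact_subsets hausdorff_dist) shift_spaces
      closure_of finite_type_shifts = shift_spaces"
proof -
  have "\<exists>Y\<in>finite_type_shifts. Y \<in> hausdorff.mball X r"
    if X: "X \<in> shift_spaces" and r: "r > 0" for X r
  proof -
    obtain k where k: "k \<ge> 2" "shift_space {1..k} X" using X by (auto simp: shift_spaces_def)
    obtain m where m: "(1/2 :: real) ^ m < r" using real_arch_pow_inv[OF r, of "1/2"] by auto
    obtain Y where Y: "subshift_of_finite_type {1..k} Y" "hausdorff_dist X Y \<le> (1/2) ^ m"
      using finite_type_approximation[OF finite_atLeastAtMost k(2)] .
    have "Y \<in> finite_type_shifts" using Y(1) k(1) by (auto simp: finite_type_shifts_def)
    then show ?thesis
      using X Y(2) m finite_type_shifts_subset shift_spaces_subset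
      by (intro bexI[of _ Y]) auto
  qed
  \<comment> \<open>Every ball around a shift space meets the finite type shifts, which is the
    metric description of closure. The closure in the subspace is the trace of this one on
    \<open>shift_spaces\<close>, so one inclusion is enough.\<close>
  then have "shift_spaces \<subseteq> hausdorff.mtopology closure_of finite_type_shifts"
    using shift_spaces_subset by (auto simp: hausdorff.metric_closure_of)
  then show ?thesis
    using finite_type_shifts_subset
    by (auto simp: closure_of_subtopology Int_absorb1)
qed

end
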